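(* Let $\mathbb{F}$ be a field of characteristic $0$, $p,q>1$ integers with $p\neq q$, $\mathcal{J}_{\mathbb{F}}$ the Jordan triple system of all $p\times q$ matrices over $\mathbb{F}$ with triple product $\{x,y,z\}=xy^tz+zy^tx$, and $\mathcal{U}(\mathcal{J}_{\mathbb{F}})$ its universal associative envelope. Then $\mathcal{U}(\mathcal{J}_{\mathbb{F}})\cong M_{(p+q)\times(p+q)}(\mathbb{F})$, the associative algebra of all $(p+q)\times(p+q)$ matrices over $\mathbb{F}$.
   Context: Put $\Omega_1=\{1,\dots,p\}$, $\Omega_2=\{1,\dots,q\}$, and let $E_{i,j}$ ($i\in\Omega_1$, $j\in\Omega_2$) be the standard matrix units of $M_{p\times q}(\mathbb{F})$. Let $\mathfrak{F}$ be the free associative algebra (without identity element) over $\mathbb{F}$ on symbols $G_{i,j}$ ($i\in\Omega_1$, $j\in\Omega_2$), and let $\Phi:\mathcal{J}_{\mathbb{F}}\to\mathfrak{F}$ be the linear map with $\Phi(E_{i,j})=G_{i,j}$. Let $I$ be the two-sided ideal of $\mathfrak{F}$ generated by all elements $G_{i,j}G_{k,\ell}G_{s,t}+G_{s,t}G_{k,\ell}G_{i,j}-\Phi(\{E_{i,j},E_{k,\ell},E_{s,t}\})$ ($i,k,s\in\Omega_1$; $j,\ell,t\in\Omega_2$). The universal associative envelope is $\mathcal{U}(\mathcal{J}_{\mathbb{F}})=\mathfrak{F}/I$. *)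

theory Defs
  imports "Jordan_Normal_Form.Matrix"
begin

text \<open>Indices are 0-based: Omega1 = {..<p}, Omega2 = {..<q}.
  The free associative algebra without identity on symbols G(i,j) is modelled
  as finitely supported coefficient functions on nonempty words over the alphabet
  {..<p} x {..<q}.\<close>

type_synonym 'a fa = "(nat \<times> nat) list \<Rightarrow> 'a"

definition free_alg :: "nat \<Rightarrow> nat \<Rightarrow> 'a::field fa set" where
  "free_alg p q = {c. finite {w. c w \<noteq> 0} \<and>
     (\<forall>w. c w \<noteq> 0 \<longrightarrow> w \<noteq> [] \<and> set w \<subseteq> {..<p} \<times> {..<q})}"

definition fa_add :: "'a::field fa \<Rightarrow> 'a fa \<Rightarrow> 'a fa" where
  "fa_add c d = (\<lambda>w. c w + d w)"

definition fa_diff :: "'a::field fa \<Rightarrow> 'a fa \<Rightarrow> 'a fa" where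
  "fa_diff c d = (\<lambda>w. c w - d w)"

definition fa_zero :: "'a::field fa" where
  "fa_zero = (\<lambda>w. 0)"

definition fa_smult :: "'a::field \<Rightarrow> 'a fa \<Rightarrow> 'a fa" where
  "fa_smult a c = (\<lambda>w. a * c w)"

text \<open>Multiplication: concatenation of words, extended bilinearly.\<close>
definition fa_mult :: "'a::field fa \<Rightarrow> 'a fa \<Rightarrow> 'a fa" where
  "fa_mult c d = (\<lambda>w. \<Sum>k\<le>length w. c (take k w) * d (drop k w))"

definition fa_gen :: "nat \<Rightarrow> nat \<Rightarrow> 'a::field fa" where
  "fa_gen i j = (\<lambda>w. if w = [(i, j)] then 1 else 0)"

definition mat_unit :: "nat \<Rightarrow> nat \<Rightarrow> nat \<Rightarrow> nat \<Rightarrow> 'a::field mat" where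
  "mat_unit p q i j = mat p q (\<lambda>(k, l). if k = i \<and> l = j then 1 else 0)"

definition jtriple :: "'a::field mat \<Rightarrow> 'a mat \<Rightarrow> 'a mat \<Rightarrow> 'a mat" where
  "jtriple x y z = x * transpose_mat y * z + z * transpose_mat y * x"

definition Phi :: "nat \<Rightarrow> nat \<Rightarrow> 'a::field mat \<Rightarrow> 'a fa" where
  "Phi p q X = (\<lambda>w. \<Sum>i<p. \<Sum>j<q. X $$ (i, j) * fa_gen i j w)"

definition env_rel :: "nat \<Rightarrow> nat \<Rightarrow> 'a::field fa set" where
  "env_rel p q = {fa_diff (fa_add (fa_mult (fa_mult (fa_gen i j) (fa_gen k l)) (fa_gen s t))
                                 (fa_mult (fa_mult (fa_gen s t) (fa_gen k l)) (fa_gen i j)))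
                         (Phi p q (jtriple (mat_unit p q i j) (mat_unit p q k l) (mat_unit p q s t)))
        | i j k l s t. i < p \<and> k < p \<and> s < p \<and> j < q \<and> l < q \<and> t < q}"

inductive_set env_ideal :: "nat \<Rightarrow> nat \<Rightarrow> 'a::field fa set" for p q where
  gen: "x \<in> env_rel p q \<Longrightarrow> x \<in> env_ideal p q"
| zero: "fa_zero \<in> env_ideal p q"
| add: "x \<in> env_ideal p q \<Longrightarrow> y \<in> env_ideal p q \<Longrightarrow> fa_add x y \<in> env_ideal p q"
| smult: "x \<in> env_ideal p q \<Longrightarrow> fa_smult a x \<in> env_ideal p q"
| left: "x \<in> env_ideal p q \<Longrightarrow> a \<in> free_alg p q \<Longrightarrow> fa_mult a x \<in> env_ideal p q"
| right: "x \<in> env_ideal p q \<Longrightarrow> a \<in> free_alg p q \<Longrightarrow> fa_mult x a \<in> env_ideal p q"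

text \<open>An algebra isomorphism U(J) = free_alg/I  -->  M_n(F), presented by an algebra
  homomorphism f from the free algebra onto M_n(F) such that f x = f y iff x - y in I,
  i.e. f induces a well-defined bijective algebra homomorphism on the quotient.\<close>
definition envelope_iso_to_mat :: "nat \<Rightarrow> nat \<Rightarrow> nat \<Rightarrow> ('a::field fa \<Rightarrow> 'a mat) \<Rightarrow> bool" where
  "envelope_iso_to_mat p q n f \<longleftrightarrow>
     (\<forall>x\<in>free_alg p q. f x \<in> carrier_mat n n) \<and>
     (\<forall>x\<in>free_alg p q. \<forall>y\<in>free_alg p q. f (fa_add x y) = f x + f y) \<and>
     (\<forall>a. \<forall>x\<in>free_alg p q. f (fa_smult a x) = a \<cdot>\<^sub>m f x) \<and>
     (\<forall>x\<in>free_alg p q. \<forall>y\<in>free_alg p q. f (fa_mult x y) = f x * f y) \<and>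
     (\<forall>M\<in>carrier_mat n n. \<exists>x\<in>free_alg p q. f x = M) \<and>
     (\<forall>x\<in>free_alg p q. \<forall>y\<in>free_alg p q. f x = f y \<longleftrightarrow> fa_diff x y \<in> env_ideal p q)"

end

theory Submission
  imports Defs
begin

text \<open>
  The representation sends \<open>G\<^sub>i\<^sub>j\<close> to \<open>E\<^sub>i\<^sub>,\<^sub>p\<^sub>+\<^sub>j + E\<^sub>p\<^sub>+\<^sub>j\<^sub>,\<^sub>i\<close>; it respects the relations, and each
  matrix unit is the image of a single word. For injectivity on the envelope, write \<open>g\<^sub>i\<^sub>j\<close> for the
  class of \<open>G\<^sub>i\<^sub>j\<close>. Since 2 is invertible, \<open>g\<^sub>i\<^sub>j\<close> equals its cube and \<open>g\<^sub>i\<^sub>j g\<^sub>k\<^sub>l g\<^sub>i\<^sub>j = 0\<close> for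
  \<open>(i, j) \<noteq> (k, l)\<close>. If \<open>i \<noteq> k\<close> and \<open>j \<noteq> l\<close>, moving \<open>g\<^sub>i\<^sub>j\<close> past the square of \<open>g\<^sub>k\<^sub>l\<close> in
  \<open>g\<^sub>i\<^sub>j g\<^sub>k\<^sub>l g\<^sub>k\<^sub>l g\<^sub>k\<^sub>l\<close> gives \<open>g\<^sub>i\<^sub>j g\<^sub>k\<^sub>l = 0\<close>. It follows that \<open>g\<^sub>i\<^sub>j g\<^sub>k\<^sub>j\<close> with \<open>i \<noteq> k\<close> does not
  depend on \<open>j\<close>, and dually for \<open>g\<^sub>i\<^sub>j g\<^sub>i\<^sub>l\<close>. Hence left multiplication by a generator permutes the
  candidate matrix units or kills them, exactly as in the matrix algebra, so their span is the
  whole envelope.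
\<close>

subsection \<open>Matrix units from Jordan triple relations\<close>

text \<open>A fixed auxiliary index. It takes only the values 0 and 1, so it is in range as soon as
  the dimension exceeds 1.\<close>

definition other :: "nat \<Rightarrow> nat" where
  "other i = (if i = 0 then 1 else 0)"

lemma other_neq [simp]: "other i \<noteq> i" "i \<noteq> other i"
  by (auto simp: other_def)

lemma other_less [simp]: "1 < n \<Longrightarrow> other i < n"
  by (auto simp: other_def)

text \<open>With \<open>flip g\<close> for the transposed family, the matrix units are
  \<open>E\<^sub>i\<^sub>,\<^sub>k = row_unit g i k\<close>, \<open>E\<^sub>i\<^sub>,\<^sub>p\<^sub>+\<^sub>j = cross_unit g i j\<close>,
  \<open>E\<^sub>p\<^sub>+\<^sub>j\<^sub>,\<^sub>i = cross_unit (flip g) j i\<close> and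
  \<open>E\<^sub>p\<^sub>+\<^sub>j\<^sub>,\<^sub>p\<^sub>+\<^sub>l = row_unit (flip g) j l\<close>.\<close>
definition row_unit :: "(nat \<Rightarrow> nat \<Rightarrow> 'b::ring) \<Rightarrow> nat \<Rightarrow> nat \<Rightarrow> 'b" where
  "row_unit g i k =
     (if i = k then g i 0 * (g (other i) 0 * (g (other i) 0 * g i 0)) else g i 0 * g k 0)"

definition cross_unit :: "(nat \<Rightarrow> nat \<Rightarrow> 'b::ring) \<Rightarrow> nat \<Rightarrow> nat \<Rightarrow> 'b" where
  "cross_unit g i j = g i 0 * (g (other i) 0 * g (other i) j)"

abbreviation (input) flip :: "('x \<Rightarrow> 'y \<Rightarrow> 'z) \<Rightarrow> 'y \<Rightarrow> 'x \<Rightarrow> 'z" where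
  "flip g \<equiv> \<lambda>j i. g i j"

text \<open>The right-hand side of \<open>triple\<close> is the evaluated Jordan product: the matrix
  product of E_{i,j}, the transpose of E_{k,l}, and E_{s,t} is E_{i,t} if j = l and k = s, and 0
  otherwise. Having p, q and g as parameters allows reinterpretation for the transposed
  family.\<close>

locale triple_generators =
  fixes p q :: nat and g :: "nat \<Rightarrow> nat \<Rightarrow> 'b::ring"
  assumes p: "1 < p" and q: "1 < q"
    and triple: "\<And>i j k l s t. \<lbrakk>i < p; k < p; s < p; j < q; l < q; t < q\<rbrakk> \<Longrightarrow>
      g i j * (g k l * g s t) + g s t * (g k l * g i j) =
        (if j = l \<and> k = s then g i t else 0) + (if t = l \<and> k = i then g s j else 0)"
    and no_two_torsion: "\<And>x :: 'b. x + x = 0 \<Longrightarrow> x = 0"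
begin

text \<open>Transposition respects the Jordan product, so the two summands on the right merely trade
  places. Every fact about rows thereby has a dual about columns.\<close>

lemma transposed: "triple_generators q p (flip g)"
proof
  fix i j k l s t assume *: "i < q" "k < q" "s < q" "j < p" "l < p" "t < p"
  show "g j i * (g l k * g t s) + g t s * (g l k * g j i) =
      (if j = l \<and> k = s then g t i else 0) + (if t = l \<and> k = i then g j s else 0)"
    by (subst triple) (use * in auto)
qed (fact p q no_two_torsion)+

section \<open>Products of two and three generators\<close>

lemma sandwich:
  assumes "i < p" "k < p" "j < q" "l < q" "(i, j) \<noteq> (k, l)"
  shows "g i j * (g k l * g i j) = 0"
  by (rule no_two_torsion) (use triple[of i k i j l j] assms in auto)

text \<open>With three equal factors the relation says that twice the cube is twice the generator.
  As in \<open>sandwich\<close>, equal outer factors double the product, and the 2 cancels.\<close>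

lemma cube:
  assumes "i < p" "j < q"
  shows "g i j * (g i j * g i j) = g i j"
proof -
  let ?x = "g i j * (g i j * g i j) - g i j"
  have "?x + ?x = 0"
    using triple[of i i i j j j] assms by (simp add: algebra_simps)
  from no_two_torsion[OF this] show ?thesis by simp
qed

lemma opposite:
  assumes "i < p" "k < p" "j < q" "l < q" "i \<noteq> k" "j \<noteq> l"
  shows "g i j * g k l = 0"
proof -
  have swap: "g i j * (g k l * g k l) = - (g k l * (g k l * g i j))"
    using triple[of i k k j l l] assms by (simp add: eq_neg_iff_add_eq_0)
  have "g i j * g k l = (g i j * (g k l * g k l)) * g k l"
    using cube[of k l] assms by (simp add: mult.assoc)
  also have "\<dots> = - (g k l * (g k l * (g i j * g k l)))"
    by (simp add: swap mult.assoc)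
  also have "\<dots> = 0"
    using sandwich[of k i l j] assms by simp
  finally show ?thesis .
qed

lemma opposite_left:
  assumes "i < p" "k < p" "j < q" "l < q" "i \<noteq> k" "j \<noteq> l"
  shows "g i j * (g k l * x) = 0"
  using opposite[OF assms] by (simp flip: mult.assoc)

text \<open>A Peirce-type decomposition: for the idempotent e, the square of \<open>g i j\<close>,
  the relation reads x = e x + x e with x = \<open>g i l\<close>.\<close>

lemma square_row:
  assumes "i < p" "j < q" "l < q" "j \<noteq> l"
  shows "g i l * (g i j * g i j) = g i l - g i j * (g i j * g i l)"
  using triple[of i i i j j l] assms by (simp add: eq_diff_eq add.commute)

text \<open>Both sides stand for the matrix unit E_{i,k}, in which no column index occurs.\<close>

lemma column_product:
  assumes "i < p" "k < p" "j < q" "l < q" "i \<noteq> k"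
  shows "g i j * g k j = g i l * g k l"
proof (cases "j = l")
  case False
  \<comment> \<open>The first factor \<open>g i l\<close> is rewritten as the Jordan product of
    \<open>g i j\<close>, \<open>g k j\<close> and \<open>g k l\<close>, which brings column j into
    play.\<close>
  have "g i l * g k l = (g i j * (g k j * g k l) + g k l * (g k j * g i j)) * g k l"
    using triple[of i k k j j l] assms False by simp
  also have "\<dots> = g i j * (g k j * (g k l * g k l)) + g k l * (g k j * (g i j * g k l))"
    by (simp add: algebra_simps)
  \<comment> \<open>The second summand contains \<open>g i j * g k l\<close>, whose indices differ
    in both places; the next step drops the subtracted term for the same reason.\<close>
  also have "\<dots> = g i j * (g k j - g k l * (g k l * g k j))"
    using assms False by (simp add: opposite square_row)
  also have "\<dots> = g i j * g k j"
    using assms False by (simp add: opposite_left right_diff_distrib)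
  finally show ?thesis by simp
qed simp

lemma row_product:
  assumes "i < p" "k < p" "j < q" "l < q" "j \<noteq> l"
  shows "g i j * g i l = g k j * g k l"
  using triple_generators.column_product[OF transposed, of j l i k] assms by simp

section \<open>Matrix units with freely chosen auxiliary indices\<close>

lemma row_unit_eq:
  assumes "i < p" "k < p" "j < q" "i \<noteq> k"
  shows "row_unit g i k = g i j * g k j"
  using column_product[of i k 0 j] assms q by (simp add: row_unit_def)

lemma row_unit_diag: "row_unit g i i = row_unit g i (other i) * row_unit g (other i) i"
  by (simp add: row_unit_def mult.assoc)

lemma cross_unit_eq: "cross_unit g i j = row_unit g i (other i) * g (other i) j"
  by (simp add: row_unit_def cross_unit_def mult.assoc)

lemma col_unit_eq:
  assumes "i < p" "j < q" "l < q" "j \<noteq> l"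
  shows "row_unit (flip g) j l = g i j * g i l"
  using triple_generators.row_unit_eq[OF transposed, of j l i] assms by simp

lemma cross_unit_flip_eq:
  "cross_unit (flip g) j i = row_unit (flip g) j (other j) * g i (other j)"
  by (simp add: row_unit_def cross_unit_def mult.assoc)

section \<open>Left multiplication of matrix units by generators\<close>

lemma gen_mult_cross_unit_flip:
  assumes st: "s < p" "t < q" and ij: "i < p" "j < q"
  shows "g s t * cross_unit (flip g) j i = (if t = j then row_unit g s i else 0)"
proof -
  \<comment> \<open>The column unit inside can be written through any row x. For t \<noteq> j, x =
    \<open>other s\<close> makes the product vanish. For t = j, x = s produces a square when s
    \<noteq> i, and x = \<open>other s\<close> splits the product into two row units when s =
    i.\<close>
  have exp: "g s t * cross_unit (flip g) j i = g s t * (g x j * (g x (other j) * g i (other j)))"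
    if "x < p" for x
    using that col_unit_eq[of x j "other j"] ij q by (simp add: cross_unit_flip_eq mult.assoc)
  consider "t \<noteq> j" | "t = j" "s \<noteq> i" | "t = j" "s = i" by blast
  then show ?thesis
  proof cases
    case 1
    then show ?thesis
      using exp[of "other s"] opposite_left[of s "other s" t j] st ij p by simp
  next
    case 2
    have "g s j * (g s j * g s (other j)) = g s (other j) - g s (other j) * (g s j * g s j)"
      using square_row[of s j "other j"] st ij q by simp
    moreover have "g s t * cross_unit (flip g) j i =
        (g s j * (g s j * g s (other j))) * g i (other j)"
      using exp[of s] st 2 by (simp add: mult.assoc)
    ultimately have "g s t * cross_unit (flip g) j i =
        (g s (other j) - g s (other j) * (g s j * g s j)) * g i (other j)"
      by simp
    \<comment> \<open>The subtracted term ends in \<open>g s j * g i (other j)\<close>, which is 0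
      because both indices differ.\<close>
    also have "\<dots> = g s (other j) * g i (other j)"
      using opposite[of s i j "other j"] st ij q 2 by (simp add: left_diff_distrib mult.assoc)
    finally show ?thesis
      using row_unit_eq[of s i "other j"] st ij q 2 by simp
  next
    case 3
    then have "g s t * cross_unit (flip g) j i =
        (g s j * g (other s) j) * (g (other s) (other j) * g s (other j))"
      using exp[of "other s"] p by (simp add: mult.assoc)
    also have "\<dots> = row_unit g s (other s) * row_unit g (other s) s"
      using row_unit_eq[of s "other s" j] row_unit_eq[of "other s" s "other j"] st ij p q by simp
    finally show ?thesis
      using 3 by (simp flip: row_unit_diag)
  qed
qed

lemma gen_mult_row_unit:
  assumes st: "s < p" "t < q" and ik: "i < p" "k < p"
  shows "g s t * row_unit g i k = (if s = i then cross_unit (flip g) t k else 0)"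
proof -
  have off: "g s t * row_unit g i k = (if s = i then cross_unit (flip g) t k else 0)"
    if "i \<noteq> k" "k < p" for k
  proof -
    \<comment> \<open>With column \<open>other t\<close> the first two factors form a column unit if
      s = i, and have both indices different otherwise.\<close>
    have "g s t * row_unit g i k = g s t * (g i (other t) * g k (other t))"
      using row_unit_eq[of i k "other t"] that ik q by simp
    also have "\<dots> = (if s = i then cross_unit (flip g) t k else 0)"
    proof (cases "s = i")
      case True
      then show ?thesis
        using col_unit_eq[of i t "other t"] st ik q by (simp add: cross_unit_flip_eq mult.assoc)
    next
      case False
      then show ?thesis
        using opposite_left[of s i t "other t"] st ik q by simp
    qed
    finally show ?thesis .
  qed
  show ?thesis
  proof (cases "i = k")
    case False
    then show ?thesis using off ik by simp
  next
    case True
    let ?C = "row_unit (flip g) t (other t)"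
    have "g s t * row_unit g i i = (g s t * row_unit g i (other i)) * row_unit g (other i) i"
      by (simp add: row_unit_diag mult.assoc)
    also have "\<dots> = (if s = i then cross_unit (flip g) t (other i) * row_unit g (other i) i else 0)"
      using off[of "other i"] p by simp
    \<comment> \<open>In matrix terms, with o = \<open>other i\<close>: E_{p+t,o} times E_{o,i} is
      E_{p+t,i}.\<close>
    also have "cross_unit (flip g) t (other i) * row_unit g (other i) i = cross_unit (flip g) t i"
    proof -
      have C: "?C = g (other i) t * g (other i) (other t)"
        using col_unit_eq[of "other i" t "other t"] st p q by simp
      have "cross_unit (flip g) t (other i) * row_unit g (other i) i =
          ?C * ((g (other i) (other t) * g (other i) t) * g i t)"
        using row_unit_eq[of "other i" i t] st ik p by (simp add: cross_unit_flip_eq mult.assoc)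
      \<comment> \<open>Moving this product from row \<open>other i\<close> to row i places two
        copies of \<open>g i t\<close> side by side, so that \<open>square_row\<close>
        applies.\<close>
      also have "g (other i) (other t) * g (other i) t = g i (other t) * g i t"
        using row_product[of "other i" i "other t" t] st ik p q by simp
      also have "?C * (g i (other t) * g i t * g i t) =
          ?C * g i (other t) - ?C * (g i t * (g i t * g i (other t)))"
        using square_row[of i t "other t"] st ik q by (simp add: mult.assoc right_diff_distrib)
      \<comment> \<open>\<open>?C\<close> ends in \<open>g (other i) (other t)\<close>, which
        annihilates \<open>g i t\<close> from the left.\<close>
      also have "?C * (g i t * (g i t * g i (other t))) = 0"
        using opposite_left[of "other i" i "other t" t] st ik p q by (simp add: C mult.assoc)
      finally show ?thesis by (simp add: cross_unit_flip_eq)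
    qed
    finally show ?thesis using True by simp
  qed
qed

lemma gen_mult_cross_unit:
  assumes "s < p" "t < q" "i < p" "j < q"
  shows "g s t * cross_unit g i j = (if s = i then row_unit (flip g) t j else 0)"
  using triple_generators.gen_mult_cross_unit_flip[OF transposed, of t s j i] assms by simp

lemma gen_mult_col_unit:
  assumes "s < p" "t < q" "j < q" "l < q"
  shows "g s t * row_unit (flip g) j l = (if t = j then cross_unit g s l else 0)"
  using triple_generators.gen_mult_row_unit[OF transposed, of t s j l] assms by simp

text \<open>The Jordan product of \<open>g i (other j)\<close>, \<open>g (other i) (other j)\<close>
  and \<open>g (other i) j\<close> is \<open>g i j\<close>, and its two summands are exactly the two
  cross units.\<close>

lemma gen_eq_cross_units:
  assumes "i < p" "j < q"
  shows "g i j = cross_unit g i j + cross_unit (flip g) j i"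
  using triple[of i "other i" "other i" "other j" "other j" j] assms p q
    row_unit_eq[of i "other i" "other j"] col_unit_eq[of "other i" j "other j"]
  by (simp add: cross_unit_eq cross_unit_flip_eq mult.assoc)

end

subsection \<open>The free algebra and the defining relations\<close>

definition words :: "nat \<Rightarrow> nat \<Rightarrow> (nat \<times> nat) list set" where
  "words p q = {w. w \<noteq> [] \<and> set w \<subseteq> {..<p} \<times> {..<q}}"

definition fa_monom :: "'a::field \<Rightarrow> (nat \<times> nat) list \<Rightarrow> 'a fa" where
  "fa_monom c w = (\<lambda>v. if v = w then c else 0)"

lemma free_alg_iff: "x \<in> free_alg p q \<longleftrightarrow> finite {w. x w \<noteq> 0} \<and> {w. x w \<noteq> 0} \<subseteq> words p q"
  by (auto simp: free_alg_def words_def)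

lemma fa_zero_in_free_alg [simp]: "fa_zero \<in> free_alg p q"
  by (simp add: free_alg_iff fa_zero_def)

lemma fa_add_in_free_alg [simp]:
  assumes "x \<in> free_alg p q" "y \<in> free_alg p q"
  shows "fa_add x y \<in> free_alg p q"
proof -
  have "{w. fa_add x y w \<noteq> 0} \<subseteq> {w. x w \<noteq> 0} \<union> {w. y w \<noteq> 0}"
    by (auto simp: fa_add_def)
  with assms show ?thesis
    unfolding free_alg_iff by (meson finite_UnI finite_subset Un_least subset_trans)
qed

lemma fa_smult_in_free_alg [simp]:
  assumes "x \<in> free_alg p q"
  shows "fa_smult c x \<in> free_alg p q"
proof -
  have "{w. fa_smult c x w \<noteq> 0} \<subseteq> {w. x w \<noteq> 0}"
    by (auto simp: fa_smult_def)
  with assms show ?thesis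
    unfolding free_alg_iff by (meson finite_subset subset_trans)
qed

lemma fa_diff_conv: "fa_diff x y = fa_add x (fa_smult (-1) y)"
  by (simp add: fa_diff_def fa_add_def fa_smult_def)

lemma fa_diff_in_free_alg [simp]:
  "x \<in> free_alg p q \<Longrightarrow> y \<in> free_alg p q \<Longrightarrow> fa_diff x y \<in> free_alg p q"
  by (simp add: fa_diff_conv)

lemma fa_mult_in_free_alg [simp]:
  assumes x: "x \<in> free_alg p q" and y: "y \<in> free_alg p q"
  shows "fa_mult x y \<in> free_alg p q"
proof -
  have sub: "{w. fa_mult x y w \<noteq> 0} \<subseteq> (\<lambda>(u, v). u @ v) ` ({w. x w \<noteq> 0} \<times> {w. y w \<noteq> 0})"
  proof
    fix w assume "w \<in> {w. fa_mult x y w \<noteq> 0}"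
    then obtain k where "x (take k w) * y (drop k w) \<noteq> 0"
      unfolding fa_mult_def using sum.not_neutral_contains_not_neutral by blast
    then show "w \<in> (\<lambda>(u, v). u @ v) ` ({w. x w \<noteq> 0} \<times> {w. y w \<noteq> 0})"
      by (intro image_eqI[of _ _ "(take k w, drop k w)"]) auto
  qed
  have "(\<lambda>(u, v). u @ v) ` ({w. x w \<noteq> 0} \<times> {w. y w \<noteq> 0}) \<subseteq> words p q"
    using x y unfolding free_alg_iff words_def by force
  with sub x y show ?thesis
    unfolding free_alg_iff
    by (meson finite_SigmaI finite_imageI finite_subset subset_trans)
qed

lemma fa_monom_in_free_alg [simp]: "w \<in> words p q \<Longrightarrow> fa_monom c w \<in> free_alg p q"
  by (auto simp: free_alg_iff fa_monom_def)

text \<open>Induction on the size of the support, splitting off one word at a time; it reduces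
  linear statements to monomials.\<close>

lemma free_alg_induct [consumes 1, case_names zero add_monom]:
  assumes "x \<in> free_alg p q"
    and "P fa_zero"
    and step: "\<And>x c w. \<lbrakk>x \<in> free_alg p q; w \<in> words p q; P x\<rbrakk> \<Longrightarrow> P (fa_add x (fa_monom c w))"
  shows "P x"
proof -
  have "finite S \<Longrightarrow> S = {w. x w \<noteq> 0} \<Longrightarrow> x \<in> free_alg p q \<Longrightarrow> P x" for S x
  proof (induction S arbitrary: x rule: finite_induct)
    case empty
    then have "x = fa_zero" by (auto simp: fa_zero_def)
    with assms(2) show ?case by simp
  next
    case (insert w S)
    define y where "y = x(w := 0)"
    have S: "S = {v. y v \<noteq> 0}" using insert by (auto simp: y_def)
    moreover have "y \<in> free_alg p q"
      using insert S unfolding free_alg_iff by (metis finite_insert insert_subset)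
    moreover have "w \<in> words p q"
      using insert unfolding free_alg_iff by blast
    moreover have "x = fa_add y (fa_monom (x w) w)"
      by (auto simp: y_def fa_add_def fa_monom_def)
    ultimately show ?case
      using insert.IH step by metis
  qed
  with assms(1) show ?thesis by (auto simp: free_alg_iff)
qed

text \<open>Of all cuts of a word in the convolution, only the one after \<open>length u\<close>
  letters can contribute.\<close>

lemma fa_monom_mult: "fa_mult (fa_monom c u) (fa_monom d v) = fa_monom (c * d) (u @ v)"
proof
  fix w
  have "fa_monom c u (take k w) * fa_monom d v (drop k w) =
      (if k = length u then (if w = u @ v then c * d else 0) else 0)" if k: "k \<le> length w" for k
  proof -
    consider "k = length u" "w = u @ v" | "take k w \<noteq> u" | "drop k w \<noteq> v"
      using k by (metis append_take_drop_id length_take min.absorb2)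
    then show ?thesis
    proof cases
      case 2
      then have "\<not> (k = length u \<and> w = u @ v)" by auto
      with 2 show ?thesis by (simp only: fa_monom_def) simp
    next
      case 3
      then have "\<not> (k = length u \<and> w = u @ v)" by auto
      with 3 show ?thesis by (simp only: fa_monom_def) simp
    qed (simp add: fa_monom_def)
  qed
  then have "fa_mult (fa_monom c u) (fa_monom d v) w =
      (\<Sum>k\<le>length w. if k = length u then (if w = u @ v then c * d else 0) else 0)"
    unfolding fa_mult_def by (intro sum.cong) auto
  also have "\<dots> = fa_monom (c * d) (u @ v) w"
    by (auto simp: fa_monom_def)
  finally show "fa_mult (fa_monom c u) (fa_monom d v) w = fa_monom (c * d) (u @ v) w" .
qed

lemma fa_gen_eq_monom: "fa_gen i j = fa_monom 1 [(i, j)]"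
  by (simp add: fa_gen_def fa_monom_def)

section \<open>Bilinearity and associativity of the product\<close>

lemma fa_add_assoc: "fa_add (fa_add x y) z = fa_add x (fa_add y z)"
  by (simp add: fa_add_def add.assoc)

lemma fa_add_commute: "fa_add x y = fa_add y x"
  by (simp add: fa_add_def add.commute)

lemma fa_zero_add [simp]: "fa_add fa_zero x = x"
  by (simp add: fa_add_def fa_zero_def)

lemma fa_neg_add [simp]: "fa_add (fa_smult (-1) x) x = fa_zero"
  by (simp add: fa_add_def fa_smult_def fa_zero_def)

lemma fa_mult_assoc: "fa_mult (fa_mult x y) z = fa_mult x (fa_mult y z)"
proof
  fix w :: "(nat \<times> nat) list"
  let ?n = "length w"
  have "fa_mult (fa_mult x y) z w =
      (\<Sum>k\<le>?n. \<Sum>m\<le>k. x (take m w) * y (drop m (take k w)) * z (drop k w))"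
    unfolding fa_mult_def sum_distrib_right by (intro sum.cong) (auto simp: min_def)
  also have "\<dots> = (\<Sum>(k, m)\<in>(SIGMA k:{..?n}. {..k}). x (take m w) * y (drop m (take k w)) * z (drop k w))"
    by (simp add: sum.Sigma)
  also have "\<dots> = (\<Sum>(m, l)\<in>(SIGMA m:{..?n}. {..?n - m}).
      x (take m w) * (y (take l (drop m w)) * z (drop l (drop m w))))"
    \<comment> \<open>Both sums run over the ways to cut w into three pieces: cut positions m \<le>
      k on one side, the cut m and the length l = k - m of the middle piece on the other.\<close>
    by (rule sum.reindex_bij_witness[of _ "\<lambda>(m, l). (m + l, m)" "\<lambda>(k, m). (m, k - m)"])
      (auto simp: drop_take mult.assoc)
  also have "\<dots> = fa_mult x (fa_mult y z) w"
    by (simp add: fa_mult_def sum_distrib_left sum.Sigma)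
  finally show "fa_mult (fa_mult x y) z w = fa_mult x (fa_mult y z) w" .
qed

lemma fa_mult_add_left: "fa_mult (fa_add x y) z = fa_add (fa_mult x z) (fa_mult y z)"
  by (simp add: fa_mult_def fa_add_def distrib_right sum.distrib)

lemma fa_mult_add_right: "fa_mult x (fa_add y z) = fa_add (fa_mult x y) (fa_mult x z)"
  by (simp add: fa_mult_def fa_add_def distrib_left sum.distrib)

lemma fa_mult_smult_left: "fa_mult (fa_smult c x) y = fa_smult c (fa_mult x y)"
  by (simp add: fa_mult_def fa_smult_def sum_distrib_left mult.assoc)

lemma fa_mult_smult_right: "fa_mult x (fa_smult c y) = fa_smult c (fa_mult x y)"
  by (simp add: fa_mult_def fa_smult_def sum_distrib_left mult.left_commute)

lemma fa_mult_diff_left: "fa_mult (fa_diff x y) z = fa_diff (fa_mult x z) (fa_mult y z)"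
  by (simp add: fa_diff_conv fa_mult_add_left fa_mult_smult_left)

lemma fa_mult_diff_right: "fa_mult x (fa_diff y z) = fa_diff (fa_mult x y) (fa_mult x z)"
  by (simp add: fa_diff_conv fa_mult_add_right fa_mult_smult_right)

lemma fa_mult_zero [simp]: "fa_mult fa_zero x = fa_zero" "fa_mult x fa_zero = fa_zero"
  by (simp_all add: fa_mult_def fa_zero_def)

lemma fa_diff_self [simp]: "fa_diff x x = fa_zero"
  by (simp add: fa_diff_def fa_zero_def)

lemma fa_diff_zero [simp]: "fa_diff x fa_zero = x"
  by (simp add: fa_diff_def fa_zero_def)

section \<open>The defining relations in terms of words\<close>

lemma index_mat_unit [simp]:
  "a < p \<Longrightarrow> b < q \<Longrightarrow> mat_unit p q i j $$ (a, b) = (if a = i \<and> b = j then 1 else 0)"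
  by (simp add: mat_unit_def)

lemma dim_mat_unit [simp]: "dim_row (mat_unit p q i j) = p" "dim_col (mat_unit p q i j) = q"
  by (simp_all add: mat_unit_def)

lemma jtriple_mat_unit:
  assumes "i < p" "k < p" "s < p" "j < q" "l < q" "t < q" "a < p" "b < q"
  shows "jtriple (mat_unit p q i j) (mat_unit p q k l) (mat_unit p q s t) $$ (a, b) =
    (if j = l \<and> k = s then (if a = i \<and> b = t then 1 else 0) else 0) +
    (if t = l \<and> k = i then (if a = s \<and> b = j then 1 else 0) else (0 :: 'a::field))"
proof -
  \<comment> \<open>General in the outer indices, so that it also covers the second summand of the
    Jordan product, where they are exchanged.\<close>
  have prod: "(mat_unit p q i j * transpose_mat (mat_unit p q k l) * mat_unit p q s t) $$ (a, b) =
      (if j = l \<and> k = s then (if a = i \<and> b = t then 1 else 0) else (0 :: 'a))"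
    if "i < p" "j < q" "s < p" "t < q" for i j s t
  proof -
    have "(mat_unit p q i j * transpose_mat (mat_unit p q k l)) $$ (a, c) =
        (if a = i \<and> c = k \<and> j = l then 1 else (0 :: 'a))" if "c < p" for c
    proof -
      have "(mat_unit p q i j * transpose_mat (mat_unit p q k l)) $$ (a, c) =
          (\<Sum>m = 0..<q. mat_unit p q i j $$ (a, m) * mat_unit p q k l $$ (c, m) :: 'a)"
        using that assms by (simp add: scalar_prod_def)
      also have "\<dots> = (\<Sum>m = 0..<q. if m = j then if a = i \<and> c = k \<and> j = l then 1 else 0 else (0 :: 'a))"
        using that assms by (intro sum.cong) auto
      finally show ?thesis using \<open>j < q\<close> by simp
    qed
    note inner = this
    have "(mat_unit p q i j * transpose_mat (mat_unit p q k l) * mat_unit p q s t) $$ (a, b) =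
        (\<Sum>c = 0..<p. (mat_unit p q i j * transpose_mat (mat_unit p q k l)) $$ (a, c) *
           mat_unit p q s t $$ (c, b) :: 'a)"
      using assms by (subst index_mult_mat) (simp_all add: scalar_prod_def)
    also have "\<dots> = (\<Sum>c = 0..<p. if c = k then if j = l \<and> k = s \<and> a = i \<and> b = t then 1 else 0 else (0 :: 'a))"
      using assms by (intro sum.cong) (auto simp: inner simp del: index_mult_mat)
    finally show ?thesis using \<open>k < p\<close> by simp
  qed
  show ?thesis
    using assms prod[of i j s t] prod[of s t i j]
    by (subst jtriple_def, subst index_add_mat) auto
qed

text \<open>A defining relator written in monomials, with its Jordan product already
  evaluated.\<close>

definition env_relator :: "nat \<Rightarrow> nat \<Rightarrow> nat \<Rightarrow> nat \<Rightarrow> nat \<Rightarrow> nat \<Rightarrow> 'a::field fa" where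
  "env_relator i j k l s t =
     fa_diff (fa_add (fa_monom 1 [(i, j), (k, l), (s, t)]) (fa_monom 1 [(s, t), (k, l), (i, j)]))
       (fa_add (if j = l \<and> k = s then fa_monom 1 [(i, t)] else fa_zero)
          (if t = l \<and> k = i then fa_monom 1 [(s, j)] else fa_zero))"

lemma Phi_jtriple:
  assumes "i < p" "k < p" "s < p" "j < q" "l < q" "t < q"
  shows "Phi p q (jtriple (mat_unit p q i j) (mat_unit p q k l) (mat_unit p q s t)) =
    (fa_add (if j = l \<and> k = s then fa_monom 1 [(i, t)] else fa_zero)
       (if t = l \<and> k = i then fa_monom 1 [(s, j)] else fa_zero) :: 'a::field fa)"
    (is "?L = ?R")
proof
  fix w
  have unit: "(\<Sum>a<p. \<Sum>b<q. (if a = i \<and> b = j then 1 else 0) * fa_gen a b w) = (fa_gen i j w :: 'a)"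
    if "i < p" "j < q" for i j
  proof -
    have "(if a = i \<and> b = j then 1 else 0) * fa_gen a b w =
        (if b = j then if a = i then fa_gen i j w else 0 else (0 :: 'a))" for a b
      by simp
    with that show ?thesis by simp
  qed
  have "Phi p q (jtriple (mat_unit p q i j) (mat_unit p q k l) (mat_unit p q s t)) w =
      (\<Sum>a<p. \<Sum>b<q.
        ((if j = l \<and> k = s then (if a = i \<and> b = t then 1 else 0) else 0) +
         (if t = l \<and> k = i then (if a = s \<and> b = j then 1 else 0) else (0 :: 'a))) * fa_gen a b w)"
    unfolding Phi_def using assms by (intro sum.cong) (auto simp: jtriple_mat_unit)
  also have "\<dots> = (if j = l \<and> k = s then fa_gen i t w else 0) + (if t = l \<and> k = i then fa_gen s j w else 0)"
    using assms unit[of i t] unit[of s j] by (auto simp: distrib_right sum.distrib)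
  finally show "?L w = ?R w"
    by (simp add: fa_add_def fa_gen_eq_monom fa_zero_def if_distrib[of "\<lambda>h. h w"])
qed

lemma env_rel_eq:
  "env_rel p q = {env_relator i j k l s t | i j k l s t.
     i < p \<and> k < p \<and> s < p \<and> j < q \<and> l < q \<and> t < q}"
proof -
  have *: "fa_diff (fa_add (fa_mult (fa_mult (fa_gen i j) (fa_gen k l)) (fa_gen s t))
          (fa_mult (fa_mult (fa_gen s t) (fa_gen k l)) (fa_gen i j)))
        (Phi p q (jtriple (mat_unit p q i j) (mat_unit p q k l) (mat_unit p q s t))) =
      (env_relator i j k l s t :: 'a fa)"
    if "i < p \<and> k < p \<and> s < p \<and> j < q \<and> l < q \<and> t < q" for i j k l s t
    using that by (simp add: env_relator_def Phi_jtriple fa_gen_eq_monom fa_monom_mult)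
  show ?thesis
    unfolding env_rel_def by (intro Collect_cong ex_cong1) (safe; simp add: *)
qed

lemma env_relator_in_env_rel:
  assumes "i < p" "k < p" "s < p" "j < q" "l < q" "t < q"
  shows "env_relator i j k l s t \<in> env_rel p q"
  unfolding env_rel_eq by (intro CollectI exI conjI) (rule refl assms)+

lemma env_relator_in_free_alg [simp]:
  assumes "i < p" "k < p" "s < p" "j < q" "l < q" "t < q"
  shows "env_relator i j k l s t \<in> free_alg p q"
  using assms by (auto simp: env_relator_def words_def)

lemma env_ideal_in_free_alg: "x \<in> env_ideal p q \<Longrightarrow> x \<in> free_alg p q"
  by (induction rule: env_ideal.induct) (auto simp: env_rel_eq)

subsection \<open>The envelope as a ring type\<close>

text \<open>Membership in \<open>free_alg\<close> is built into the relation, which is therefore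
  reflexive only on families of elements of the free algebras.\<close>

definition env_cong :: "(nat \<Rightarrow> nat \<Rightarrow> 'a::field fa) \<Rightarrow> (nat \<Rightarrow> nat \<Rightarrow> 'a fa) \<Rightarrow> bool" where
  "env_cong X Y \<longleftrightarrow> (\<forall>p q. X p q \<in> free_alg p q \<and> Y p q \<in> free_alg p q \<and>
     fa_diff (X p q) (Y p q) \<in> env_ideal p q)"

lemma env_ideal_sym: "fa_diff x y \<in> env_ideal p q \<Longrightarrow> fa_diff y x \<in> env_ideal p q"
  using env_ideal.smult[of "fa_diff x y" p q "-1"]
  by (simp add: fa_diff_def fa_smult_def)

lemma env_ideal_trans:
  "fa_diff x y \<in> env_ideal p q \<Longrightarrow> fa_diff y z \<in> env_ideal p q \<Longrightarrow> fa_diff x z \<in> env_ideal p q"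
  using env_ideal.add[of "fa_diff x y" p q "fa_diff y z"]
  by (simp add: fa_diff_def fa_add_def)

lemma env_ideal_cong_add:
  assumes "fa_diff x x' \<in> env_ideal p q" "fa_diff y y' \<in> env_ideal p q"
  shows "fa_diff (fa_add x y) (fa_add x' y') \<in> env_ideal p q"
  using env_ideal.add[OF assms] by (simp add: fa_diff_def fa_add_def algebra_simps)

lemma env_ideal_cong_smult:
  assumes "fa_diff x y \<in> env_ideal p q"
  shows "fa_diff (fa_smult c x) (fa_smult c y) \<in> env_ideal p q"
  using env_ideal.smult[OF assms, of c] by (simp add: fa_diff_def fa_smult_def algebra_simps)

text \<open>The usual splitting xy - x'y' = (x - x')y + x'(y - y'); the ideal rules then require
  just y and x' to lie in the free algebra.\<close>

lemma env_ideal_cong_mult: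
  assumes "fa_diff x x' \<in> env_ideal p q" "fa_diff y y' \<in> env_ideal p q"
    and "x' \<in> free_alg p q" "y \<in> free_alg p q"
  shows "fa_diff (fa_mult x y) (fa_mult x' y') \<in> env_ideal p q"
proof (rule env_ideal_trans)
  show "fa_diff (fa_mult x y) (fa_mult x' y) \<in> env_ideal p q"
    using env_ideal.right[OF assms(1,4)] by (simp add: fa_mult_diff_left)
  show "fa_diff (fa_mult x' y) (fa_mult x' y') \<in> env_ideal p q"
    using env_ideal.left[OF assms(2,3)] by (simp add: fa_mult_diff_right)
qed

text \<open>A ring type cannot depend on the numbers \<open>p\<close> and \<open>q\<close>, so this is the product of the
  envelopes for all \<open>p\<close> and \<open>q\<close> at once.\<close>
quotient_type (overloaded) 'a envelopes = "nat \<Rightarrow> nat \<Rightarrow> 'a::field fa" / partial: env_cong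
proof (rule part_equivpI)
  show "\<exists>X :: nat \<Rightarrow> nat \<Rightarrow> 'a fa. env_cong X X"
    by (rule exI[of _ "\<lambda>_ _. fa_zero"]) (simp add: env_cong_def env_ideal.zero)
  show "symp (env_cong :: _ \<Rightarrow> (nat \<Rightarrow> nat \<Rightarrow> 'a fa) \<Rightarrow> _)"
  proof (rule sympI)
    fix X Y :: "nat \<Rightarrow> nat \<Rightarrow> 'a fa"
    assume XY: "env_cong X Y"
    have "fa_diff (Y p q) (X p q) \<in> env_ideal p q" for p q
      by (rule env_ideal_sym) (use XY in \<open>simp add: env_cong_def\<close>)
    with XY show "env_cong Y X" by (simp add: env_cong_def)
  qed
  show "transp (env_cong :: _ \<Rightarrow> (nat \<Rightarrow> nat \<Rightarrow> 'a fa) \<Rightarrow> _)"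
  proof (rule transpI)
    fix X Y Z :: "nat \<Rightarrow> nat \<Rightarrow> 'a fa"
    assume XY: "env_cong X Y" and YZ: "env_cong Y Z"
    have "fa_diff (X p q) (Z p q) \<in> env_ideal p q" for p q
      by (rule env_ideal_trans[of _ "Y p q"]) (use XY YZ in \<open>simp_all add: env_cong_def\<close>)
    with XY YZ show "env_cong X Z" by (simp add: env_cong_def)
  qed
qed

instantiation envelopes :: (field) ring
begin

lift_definition zero_envelopes :: "'a envelopes" is "\<lambda>_ _. fa_zero"
  by (simp add: env_cong_def env_ideal.zero)

lift_definition plus_envelopes :: "'a envelopes \<Rightarrow> 'a envelopes \<Rightarrow> 'a envelopes"
  is "\<lambda>X Y p q. fa_add (X p q) (Y p q)"
  by (simp add: env_cong_def env_ideal_cong_add)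

lift_definition uminus_envelopes :: "'a envelopes \<Rightarrow> 'a envelopes"
  is "\<lambda>X p q. fa_smult (-1) (X p q)"
  by (simp add: env_cong_def env_ideal_cong_smult)

lift_definition minus_envelopes :: "'a envelopes \<Rightarrow> 'a envelopes \<Rightarrow> 'a envelopes"
  is "\<lambda>X Y p q. fa_add (X p q) (fa_smult (-1) (Y p q))"
  by (simp add: env_cong_def env_ideal_cong_add env_ideal_cong_smult)

lift_definition times_envelopes :: "'a envelopes \<Rightarrow> 'a envelopes \<Rightarrow> 'a envelopes"
  is "\<lambda>X Y p q. fa_mult (X p q) (Y p q)"
  by (simp add: env_cong_def env_ideal_cong_mult)

instance
proof
  fix a b c :: "'a envelopes"
  show "a + b + c = a + (b + c)"
    by transfer (simp add: env_cong_def env_ideal.zero fa_add_assoc)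
  show "a + b = b + a"
    by transfer (simp add: env_cong_def env_ideal.zero fa_add_commute)
  show "0 + a = a"
    by transfer (simp add: env_cong_def env_ideal.zero)
  show "- a + a = 0"
    by transfer (simp add: env_cong_def env_ideal.zero)
  show "a - b = a + - b"
    by transfer (simp add: env_cong_def env_ideal.zero)
  show "a * b * c = a * (b * c)"
    by transfer (simp add: env_cong_def env_ideal.zero fa_mult_assoc)
  show "(a + b) * c = a * c + b * c"
    by transfer (simp add: env_cong_def env_ideal.zero fa_mult_add_left)
  show "a * (b + c) = a * b + a * c"
    by transfer (simp add: env_cong_def env_ideal.zero fa_mult_add_right)
qed

end

subsection \<open>Matrix units in the envelope\<close>

text \<open>Embeds the envelope for one pair p, q as a factor of the product of all
  envelopes.\<close>

definition env_class :: "nat \<Rightarrow> nat \<Rightarrow> 'a::field fa \<Rightarrow> 'a envelopes" where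
  "env_class p q x = abs_envelopes (\<lambda>p' q'. if p' = p \<and> q' = q then x else fa_zero)"

lemma env_cong_single:
  assumes "x \<in> free_alg p q" "y \<in> free_alg p q"
  shows "env_cong (\<lambda>p' q'. if p' = p \<and> q' = q then x else fa_zero)
      (\<lambda>p' q'. if p' = p \<and> q' = q then y else fa_zero) \<longleftrightarrow> fa_diff x y \<in> env_ideal p q"
proof -
  have "env_cong (\<lambda>p' q'. if p' = p \<and> q' = q then x else fa_zero)
      (\<lambda>p' q'. if p' = p \<and> q' = q then y else fa_zero) \<longleftrightarrow>
      (\<forall>p' q'. p' = p \<and> q' = q \<longrightarrow> fa_diff x y \<in> env_ideal p q)"
    unfolding env_cong_def using assms by (intro all_cong1) (auto simp: env_ideal.zero)
  then show ?thesis by simp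
qed

text \<open>Turns identities computed in the ring type into membership in the ideal, and
  back.\<close>

lemma env_class_eq_iff:
  fixes x y :: "'a::field fa"
  assumes "x \<in> free_alg p q" "y \<in> free_alg p q"
  shows "env_class p q x = env_class p q y \<longleftrightarrow> fa_diff x y \<in> env_ideal p q"
proof -
  let ?single = "\<lambda>x p' q'. if p' = p \<and> q' = q then x else fa_zero"
  have refl: "env_cong (?single z) (?single z)" if "z \<in> free_alg p q" for z :: "'a fa"
    using env_cong_single[OF that that] by (simp add: env_ideal.zero)
  have "env_cong (?single x) (?single y) \<longleftrightarrow> env_class p q x = env_class p q y"
    unfolding env_class_def
    using Quotient_rel[OF Quotient_envelopes, of "?single x" "?single y"] refl assms by simp
  then show ?thesis by (simp add: env_cong_single assms)
qed

lemma env_class_zero [simp]: "env_class p q fa_zero = 0"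
  by (simp add: env_class_def zero_envelopes.abs_eq)

lemma env_class_add:
  assumes "x \<in> free_alg p q" "y \<in> free_alg p q"
  shows "env_class p q (fa_add x y) = env_class p q x + env_class p q y"
proof -
  have "(\<lambda>p' q'. if p' = p \<and> q' = q then fa_add x y else fa_zero) =
      (\<lambda>p' q'. fa_add (if p' = p \<and> q' = q then x else fa_zero)
        (if p' = p \<and> q' = q then y else fa_zero))"
    by (intro ext) simp
  then show ?thesis
    using assms by (simp add: env_class_def plus_envelopes.abs_eq env_cong_single env_ideal.zero)
qed

lemma env_class_mult:
  assumes "x \<in> free_alg p q" "y \<in> free_alg p q"
  shows "env_class p q (fa_mult x y) = env_class p q x * env_class p q y"
proof -
  have "(\<lambda>p' q'. if p' = p \<and> q' = q then fa_mult x y else fa_zero) =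
      (\<lambda>p' q'. fa_mult (if p' = p \<and> q' = q then x else fa_zero)
        (if p' = p \<and> q' = q then y else fa_zero))"
    by (intro ext) simp
  then show ?thesis
    using assms by (simp add: env_class_def times_envelopes.abs_eq env_cong_single env_ideal.zero)
qed

text \<open>Scalars act on representatives here, since the ring structure on
  \<open>envelopes\<close> carries no scalar action; this keeps the action compatible with equality
  of classes.\<close>

lemma env_class_smult_cong:
  assumes "x \<in> free_alg p q" "y \<in> free_alg p q" "env_class p q x = env_class p q y"
  shows "env_class p q (fa_smult c x) = env_class p q (fa_smult c y)"
  using assms env_ideal_cong_smult[of x y p q c] by (simp add: env_class_eq_iff)

lemma fa_smult_simps [simp]:
  "fa_smult c (fa_monom d w) = fa_monom (c * d) w"
  "fa_smult c fa_zero = fa_zero"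
  by (auto simp: fa_smult_def fa_monom_def fa_zero_def)

lemma fa_smult_add: "fa_smult c (fa_add x y) = fa_add (fa_smult c x) (fa_smult c y)"
  by (simp add: fa_smult_def fa_add_def distrib_left)

text \<open>The characteristic enters here: the ideal is closed under multiplication by 1/2.\<close>

lemma envelopes_no_two_torsion:
  fixes x :: "'a::field_char_0 envelopes"
  assumes "x + x = 0"
  shows "x = 0"
  using assms
proof transfer
  fix X :: "nat \<Rightarrow> nat \<Rightarrow> 'a fa"
  assume X: "env_cong X X" and "env_cong (\<lambda>p q. fa_add (X p q) (X p q)) (\<lambda>p q. fa_zero)"
  then have "fa_smult (1 / 2) (fa_add (X p q) (X p q)) \<in> env_ideal p q" for p q
    by (simp add: env_cong_def env_ideal.smult)
  moreover have "fa_smult (1 / 2) (fa_add x x) = x" for x :: "'a fa"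
    by (simp add: fa_smult_def fa_add_def)
  ultimately show "env_cong X (\<lambda>p q. fa_zero)"
    using X by (simp add: env_cong_def)
qed

lemma env_class_monom_Cons:
  assumes "i < p" "j < q" "w \<in> words p q"
  shows "env_class p q (fa_monom c ((i, j) # w)) =
    env_class p q (fa_monom 1 [(i, j)]) * env_class p q (fa_monom c w)"
proof -
  have "[(i, j)] \<in> words p q" using assms by (simp add: words_def)
  then show ?thesis
    using assms by (simp add: fa_monom_mult flip: env_class_mult)
qed

lemma words_Cons [simp]: "(i, j) # w \<in> words p q \<longleftrightarrow> i < p \<and> j < q \<and> (w = [] \<or> w \<in> words p q)"
  by (auto simp: words_def)

definition env_gen :: "nat \<Rightarrow> nat \<Rightarrow> nat \<Rightarrow> nat \<Rightarrow> 'a::field envelopes" where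
  "env_gen p q i j = env_class p q (fa_monom 1 [(i, j)])"

lemma triple_generators_env_gen:
  assumes "1 < p" "1 < q"
  shows "triple_generators p q (env_gen p q :: _ \<Rightarrow> _ \<Rightarrow> 'a::field_char_0 envelopes)"
proof
  fix i j k l s t assume *: "i < p" "k < p" "s < p" "j < q" "l < q" "t < q"
  define L R :: "'a fa" where
    "L = fa_add (fa_monom 1 [(i, j), (k, l), (s, t)]) (fa_monom 1 [(s, t), (k, l), (i, j)])" and
    "R = fa_add (if j = l \<and> k = s then fa_monom 1 [(i, t)] else fa_zero)
          (if t = l \<and> k = i then fa_monom 1 [(s, j)] else fa_zero)"
  have "fa_diff L R \<in> env_ideal p q"
    unfolding L_def R_def env_relator_def[symmetric]
    by (intro env_ideal.gen env_relator_in_env_rel *)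
  then have "env_class p q L = env_class p q R"
    using * by (subst env_class_eq_iff) (auto simp: L_def R_def)
  moreover have "env_class p q L = env_gen p q i j * (env_gen p q k l * env_gen p q s t) +
      env_gen p q s t * (env_gen p q k l * env_gen p q i j)"
    using * by (simp add: L_def env_class_add env_class_monom_Cons env_gen_def)
  moreover have "env_class p q R = (if j = l \<and> k = s then env_gen p q i t else 0) +
      (if t = l \<and> k = i then env_gen p q s j else 0)"
    using * by (simp add: R_def env_class_add env_gen_def)
  ultimately show "env_gen p q i j * (env_gen p q k l * env_gen p q s t) +
      env_gen p q s t * (env_gen p q k l * env_gen p q i j) =
      (if j = l \<and> k = s then env_gen p q i t else 0) +
      (if t = l \<and> k = i then env_gen p q s j else (0 :: 'a envelopes))"
    by simp
qed (fact assms envelopes_no_two_torsion)+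

section \<open>Words representing the matrix units\<close>

definition row_word :: "nat \<Rightarrow> nat \<Rightarrow> (nat \<times> nat) list" where
  "row_word i k =
     (if i = k then [(i, 0), (other i, 0), (other i, 0), (i, 0)] else [(i, 0), (k, 0)])"

definition cross_word :: "nat \<Rightarrow> nat \<Rightarrow> (nat \<times> nat) list" where
  "cross_word i j = [(i, 0), (other i, 0), (other i, j)]"

text \<open>A single word for E_{a,b}, chosen by block. The blocks with a \<ge> p come from the
  transposed family, hence the swapped letters.\<close>

definition unit_word :: "nat \<Rightarrow> nat \<Rightarrow> nat \<Rightarrow> (nat \<times> nat) list" where
  "unit_word p a b =
     (if a < p then if b < p then row_word a b else cross_word a (b - p)
      else map prod.swap (if b < p then cross_word (a - p) b else row_word (a - p) (b - p)))"

lemma unit_word_in_words: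
  assumes "1 < p" "1 < q" "a < p + q" "b < p + q"
  shows "unit_word p a b \<in> words p q"
  using assms by (auto simp: unit_word_def row_word_def cross_word_def)

lemma env_class_unit_word:
  fixes p q :: nat
  defines "g \<equiv> env_gen p q :: _ \<Rightarrow> _ \<Rightarrow> 'a::field envelopes"
  assumes "1 < p" "1 < q" "a < p + q" "b < p + q"
  shows "env_class p q (fa_monom 1 (unit_word p a b)) =
    (if a < p then if b < p then row_unit g a b else cross_unit g a (b - p)
     else if b < p then cross_unit (flip g) (a - p) b else row_unit (flip g) (a - p) (b - p))"
proof -
  have "0 < p" "0 < q" "a - p < q \<or> a < p" "b - p < q \<or> b < p" using assms by auto
  with assms(2-) show ?thesis
    unfolding unit_word_def row_word_def cross_word_def row_unit_def cross_unit_def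
    by (simp add: env_class_monom_Cons flip: env_gen_def g_def)
qed

text \<open>The generator acts as E_{s,p+t} + E_{p+t,s}: it exchanges rows s and p + t and kills all
  others. The four block rules give the case d = 1, which is then scaled on representatives.\<close>

lemma env_gen_mult_unit_word:
  fixes d :: "'a::field_char_0"
  assumes pq: "1 < p" "1 < q" and ab: "a < p + q" "b < p + q" and st: "s < p" "t < q"
  shows "env_gen p q s t * env_class p q (fa_monom d (unit_word p a b)) =
    (if a = s then env_class p q (fa_monom d (unit_word p (p + t) b))
     else if a = p + t then env_class p q (fa_monom d (unit_word p s b)) else 0)"
proof -
  interpret triple_generators p q "env_gen p q :: _ \<Rightarrow> _ \<Rightarrow> 'a envelopes"
    by (rule triple_generators_env_gen) (fact pq)+
  define y :: "'a fa" where "y =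
    (if a = s then fa_monom 1 (unit_word p (p + t) b)
     else if a = p + t then fa_monom 1 (unit_word p s b) else fa_zero)"
  have y: "y \<in> free_alg p q"
    using unit_word_in_words[OF pq] ab st by (simp add: y_def)
  have w: "unit_word p a b \<in> words p q" "(s, t) # unit_word p a b \<in> words p q"
    using unit_word_in_words[OF pq ab] st by simp_all
  have ineq: "a - p < q \<or> a < p" "b - p < q \<or> b < p" using ab by auto
  have "env_class p q (fa_monom 1 ((s, t) # unit_word p a b)) =
      env_gen p q s t * env_class p q (fa_monom 1 (unit_word p a b))"
    using w st by (simp add: env_class_monom_Cons env_gen_def)
  also have "\<dots> = env_class p q y"
    using pq ab st ineq
    by (auto simp: y_def env_class_unit_word gen_mult_row_unit gen_mult_col_unit
        gen_mult_cross_unit gen_mult_cross_unit_flip)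
  finally have "env_class p q (fa_smult d (fa_monom 1 ((s, t) # unit_word p a b))) =
      env_class p q (fa_smult d y)"
    using w y by (intro env_class_smult_cong) simp_all
  then show ?thesis
    using w st by (simp add: env_class_monom_Cons env_gen_def y_def split: if_splits)
qed

lemma env_class_gen_eq:
  fixes c :: "'a::field_char_0"
  assumes pq: "1 < p" "1 < q" and st: "s < p" "t < q"
  shows "env_class p q (fa_monom c [(s, t)]) =
    env_class p q (fa_monom c (unit_word p s (p + t))) +
    env_class p q (fa_monom c (unit_word p (p + t) s))"
proof -
  interpret triple_generators p q "env_gen p q :: _ \<Rightarrow> _ \<Rightarrow> 'a envelopes"
    by (rule triple_generators_env_gen) (fact pq)+
  define y :: "'a fa" where
    "y = fa_add (fa_monom 1 (unit_word p s (p + t))) (fa_monom 1 (unit_word p (p + t) s))"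
  have w: "unit_word p s (p + t) \<in> words p q" "unit_word p (p + t) s \<in> words p q"
    using unit_word_in_words[OF pq] st by simp_all
  then have "env_class p q (fa_monom 1 [(s, t)]) = env_class p q y"
    using gen_eq_cross_units[OF st] pq st
    by (simp add: y_def env_class_add env_class_unit_word env_gen_def)
  then have "env_class p q (fa_smult c (fa_monom 1 [(s, t)])) = env_class p q (fa_smult c y)"
    using w st by (intro env_class_smult_cong) (simp_all add: y_def)
  then show ?thesis
    using w by (simp add: y_def fa_smult_add env_class_add)
qed

subsection \<open>The matrix representation\<close>

text \<open>Entry (a, b) of the product of the matrices E_{i,p+j} + E_{p+j,i} along the word. Each
  of them has at most one nonzero entry per row, so the recursion follows a single path; the empty
  word gives the identity matrix.\<close>

fun word_mat :: "nat \<Rightarrow> (nat \<times> nat) list \<Rightarrow> nat \<Rightarrow> nat \<Rightarrow> 'a::field" where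
  "word_mat p [] a b = (if a = b then 1 else 0)"
| "word_mat p ((i, j) # w) a b =
     (if a = i then word_mat p w (p + j) b else if a = p + j then word_mat p w i b else 0)"

definition fa_entry :: "nat \<Rightarrow> nat \<Rightarrow> nat \<Rightarrow> 'a::field fa \<Rightarrow> 'a" where
  "fa_entry p a b x = (\<Sum>w | x w \<noteq> 0. x w * word_mat p w a b)"

definition fa_rep :: "nat \<Rightarrow> nat \<Rightarrow> 'a::field fa \<Rightarrow> 'a mat" where
  "fa_rep p q x = mat (p + q) (p + q) (\<lambda>(a, b). fa_entry p a b x)"

lemma index_fa_rep: "a < p + q \<Longrightarrow> b < p + q \<Longrightarrow> fa_rep p q x $$ (a, b) = fa_entry p a b x"
  by (simp add: fa_rep_def)

lemma fa_entry_superset: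
  assumes "finite S" "{w. x w \<noteq> 0} \<subseteq> S"
  shows "fa_entry p a b x = (\<Sum>w\<in>S. x w * word_mat p w a b)"
  unfolding fa_entry_def using assms by (intro sum.mono_neutral_left) auto

lemma fa_entry_zero [simp]: "fa_entry p a b fa_zero = 0"
  by (simp add: fa_entry_def fa_zero_def)

lemma fa_entry_add:
  assumes "x \<in> free_alg p q" "y \<in> free_alg p q"
  shows "fa_entry p a b (fa_add x y) = fa_entry p a b x + fa_entry p a b y"
proof -
  let ?S = "{w. x w \<noteq> 0} \<union> {w. y w \<noteq> 0}"
  have S: "finite ?S" using assms by (simp add: free_alg_iff)
  have "{w. fa_add x y w \<noteq> 0} \<subseteq> ?S" by (auto simp: fa_add_def)
  then have "fa_entry p a b (fa_add x y) = (\<Sum>w\<in>?S. fa_add x y w * word_mat p w a b)"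
    by (rule fa_entry_superset[OF S])
  also have "\<dots> = (\<Sum>w\<in>?S. x w * word_mat p w a b) + (\<Sum>w\<in>?S. y w * word_mat p w a b)"
    by (simp add: fa_add_def distrib_right sum.distrib)
  also have "\<dots> = fa_entry p a b x + fa_entry p a b y"
    using fa_entry_superset[OF S, of x p a b] fa_entry_superset[OF S, of y p a b] by simp
  finally show ?thesis .
qed

lemma fa_entry_smult: "fa_entry p a b (fa_smult c x) = c * fa_entry p a b x"
  by (cases "c = 0") (simp_all add: fa_entry_def fa_smult_def sum_distrib_left mult.assoc)

lemma fa_entry_diff:
  assumes "x \<in> free_alg p q" "y \<in> free_alg p q"
  shows "fa_entry p a b (fa_diff x y) = fa_entry p a b x - fa_entry p a b y"
  using assms by (simp add: fa_diff_conv fa_entry_add fa_entry_smult)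

lemma fa_entry_monom [simp]: "fa_entry p a b (fa_monom c w) = c * word_mat p w a b"
  by (subst fa_entry_superset[of "{w}"]) (auto simp: fa_monom_def)

text \<open>Multiplicativity on words. The bound on the letters keeps every row visited below p + q,
  inside the range of the sum.\<close>

lemma word_mat_append:
  assumes "set u \<subseteq> {..<p} \<times> {..<q}" "a < p + q"
  shows "word_mat p (u @ v) a b = (\<Sum>c<p + q. word_mat p u a c * word_mat p v c b :: 'a::field)"
  using assms
proof (induction u arbitrary: a)
  case Nil
  have "(\<Sum>c<p + q. word_mat p [] a c * word_mat p v c b) =
      (\<Sum>c<p + q. if c = a then word_mat p v a b else (0 :: 'a))"
    by (intro sum.cong) auto
  then show ?case using Nil by simp
next
  case (Cons x u)
  obtain i j where "x = (i, j)" by (cases x)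
  then show ?case using Cons by simp
qed

lemma fa_entry_mult:
  assumes x: "x \<in> free_alg p q" and y: "y \<in> free_alg p q" and a: "a < p + q"
  shows "fa_entry p a b (fa_mult x y) = (\<Sum>c<p + q. fa_entry p a c x * fa_entry p c b y)"
  using x
proof (induction rule: free_alg_induct)
  case zero
  then show ?case by simp
next
  case (add_monom x d u)
  have "fa_entry p a b (fa_mult (fa_monom d u) y) =
      (\<Sum>c<p + q. fa_entry p a c (fa_monom d u) * fa_entry p c b y)"
    using y
  proof (induction rule: free_alg_induct)
    case zero
    then show ?case by simp
  next
    case (add_monom y e v)
    have "word_mat p (u @ v) a b = (\<Sum>c<p + q. word_mat p u a c * word_mat p v c b :: 'a)"
      using \<open>u \<in> words p q\<close> a by (intro word_mat_append) (auto simp: words_def)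
    then have "fa_entry p a b (fa_mult (fa_monom d u) (fa_monom e v)) =
        (\<Sum>c<p + q. d * word_mat p u a c * (e * word_mat p v c b))"
      by (simp add: fa_monom_mult sum_distrib_left ac_simps)
    moreover have "fa_mult (fa_monom d u) (fa_monom e v) \<in> free_alg p q"
      using \<open>u \<in> words p q\<close> add_monom by simp
    ultimately show ?case
      using add_monom \<open>u \<in> words p q\<close>
      by (simp add: fa_mult_add_right fa_entry_add[of _ p q] distrib_left sum.distrib)
  qed
  then show ?case
    using add_monom y by (simp add: fa_mult_add_left fa_entry_add[of _ p q] distrib_right sum.distrib)
qed

lemma word_mat_unit_word:
  assumes "1 < p" "1 < q" "a < p + q" "b < p + q" "c < p + q" "d < p + q"
  shows "word_mat p (unit_word p a b) c d = (if c = a \<and> d = b then 1 else 0)"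
proof -
  have "0 < p" "0 < q" using assms by auto
  then consider "a < p" "b < p" | j where "a < p" "b = p + j" "j < q"
    | i where "a = p + i" "i < q" "b < p" | i j where "a = p + i" "i < q" "b = p + j" "j < q"
    using assms by (metis add_less_cancel_left le_Suc_ex not_le)
  then show ?thesis
    by cases (use assms in \<open>auto simp: unit_word_def row_word_def cross_word_def\<close>)
qed

text \<open>The matrices E_{i,p+j} + E_{p+j,i} satisfy the defining relations, and linearity and
  multiplicativity carry the vanishing through the ideal rules.\<close>

lemma fa_entry_env_ideal:
  assumes "x \<in> env_ideal p q" "a < p + q" "b < p + q"
  shows "fa_entry p a b x = 0"
  using assms
\<comment> \<open>The position must vary: an entry of a product involves a whole row or column of
  the factor from the ideal.\<close>
proof (induction arbitrary: a b rule: env_ideal.induct)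
  case (gen x)
  then obtain i j k l s t where x: "x = env_relator i j k l s t"
    and *: "i < p" "k < p" "s < p" "j < q" "l < q" "t < q"
    by (auto simp: env_rel_eq)
  then show ?case
    unfolding x env_relator_def using *
    by (subst fa_entry_diff[of _ p q], simp, simp, (subst fa_entry_add[of _ p q], simp, simp)+) auto
next
  case (add x y)
  then show ?case by (simp add: fa_entry_add[of _ p q] env_ideal_in_free_alg)
next
  case (left x y)
  then show ?case by (simp add: fa_entry_mult[of _ p q] env_ideal_in_free_alg)
next
  case (right x y)
  then show ?case by (simp add: fa_entry_mult[of _ p q] env_ideal_in_free_alg)
qed (simp_all add: fa_entry_smult)

section \<open>Expansion of envelope classes in matrix units\<close>

lemma sum_two_deltas:
  fixes A B :: "'b::comm_monoid_add" and p q s t :: nat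
  assumes "s < p" "t < q"
  shows "(\<Sum>a<p + q. if a = s then A else if a = p + t then B else 0) = A + B"
proof -
  have "(\<Sum>a<p + q. if a = s then A else if a = p + t then B else 0) =
      (\<Sum>a<p + q. (if a = s then A else 0) + (if a = p + t then B else 0))"
    \<comment> \<open>The two positions are distinct because s < p \<le> p + t.\<close>
    using assms by (intro sum.cong) auto
  with assms show ?thesis by (simp add: sum.distrib)
qed

text \<open>Induction on the word from the left: prefixing a generator moves the rows of matrix
  units in the envelope exactly as \<open>word_mat\<close> moves the rows of coefficients. The
  coefficients sit inside the monomials.\<close>

lemma env_class_monom_expansion:
  fixes c :: "'a::field_char_0"
  assumes pq: "1 < p" "1 < q" and w: "w \<in> words p q"
  shows "env_class p q (fa_monom c w) =
    (\<Sum>a<p + q. \<Sum>b<p + q. env_class p q (fa_monom (c * word_mat p w a b) (unit_word p a b)))"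
proof -
  have zero: "fa_monom (0 :: 'a) v = fa_zero" for v
    by (auto simp: fa_monom_def fa_zero_def)
  have "w \<noteq> []" using w by (simp add: words_def)
  then show ?thesis using w
  proof (induction w rule: list_nonempty_induct)
    case (single x)
    obtain s t where x: "x = (s, t)" by (cases x)
    then have st: "s < p" "t < q" using single by simp_all
    have "env_class p q (fa_monom c [x]) = env_class p q (fa_monom c (unit_word p s (p + t))) +
        env_class p q (fa_monom c (unit_word p (p + t) s))"
      using env_class_gen_eq[OF pq st] by (simp add: x)
    also have "\<dots> = (\<Sum>a<p + q. if a = s then env_class p q (fa_monom c (unit_word p s (p + t)))
          else if a = p + t then env_class p q (fa_monom c (unit_word p (p + t) s)) else 0)"
      by (rule sum_two_deltas[OF st, symmetric])
    also have "\<dots> = (\<Sum>a<p + q. \<Sum>b<p + q.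
        env_class p q (fa_monom (c * word_mat p [x] a b) (unit_word p a b)))"
    proof (intro sum.cong refl)
      fix a assume "a \<in> {..<p + q}"
      have "(\<Sum>b<p + q. env_class p q (fa_monom (c * word_mat p [x] a b) (unit_word p a b))) =
          (\<Sum>b<p + q. if a = s then if b = p + t then env_class p q (fa_monom c (unit_word p s (p + t))) else 0
            else if a = p + t then if b = s then env_class p q (fa_monom c (unit_word p (p + t) s)) else 0
            else 0)"
        by (intro sum.cong) (auto simp: x zero)
      also have "\<dots> = (if a = s then env_class p q (fa_monom c (unit_word p s (p + t)))
           else if a = p + t then env_class p q (fa_monom c (unit_word p (p + t) s)) else 0)"
        using st by simp
      finally show "(if a = s then env_class p q (fa_monom c (unit_word p s (p + t)))
           else if a = p + t then env_class p q (fa_monom c (unit_word p (p + t) s)) else 0) =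
          (\<Sum>b<p + q. env_class p q (fa_monom (c * word_mat p [x] a b) (unit_word p a b)))"
        by (rule sym)
    qed
    finally show ?case .
  next
    case (cons x w)
    obtain s t where x: "x = (s, t)" by (cases x)
    then have st: "s < p" "t < q" and w: "w \<in> words p q" using cons by simp_all
    \<comment> \<open>\<open>?T a a'\<close> attaches the coefficients of row a to the matrix units
      of row a'. Multiplication by the generator turns \<open>?T s s\<close> into
      \<open>?T s (p + t)\<close> and \<open>?T (p + t) (p + t)\<close> into
      \<open>?T (p + t) s\<close>.\<close>
    let ?T = "\<lambda>a a'. \<Sum>b<p + q. env_class p q (fa_monom (c * word_mat p w a b) (unit_word p a' b))"
    have "env_class p q (fa_monom c (x # w)) = env_gen p q s t * (\<Sum>a<p + q. ?T a a)"
      using cons.IH[OF w] st w by (simp add: x env_class_monom_Cons env_gen_def)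
    also have "\<dots> = (\<Sum>a<p + q. if a = s then ?T s (p + t) else if a = p + t then ?T (p + t) s else 0)"
      unfolding sum_distrib_left
    proof (intro sum.cong refl)
      fix a assume "a \<in> {..<p + q}"
      then show "(\<Sum>b<p + q. env_gen p q s t *
            env_class p q (fa_monom (c * word_mat p w a b) (unit_word p a b))) =
          (if a = s then ?T s (p + t) else if a = p + t then ?T (p + t) s else 0)"
        using pq st by (simp add: env_gen_mult_unit_word)
    qed
    also have "\<dots> = ?T (p + t) s + ?T s (p + t)"
      using sum_two_deltas[OF st] by (simp add: add.commute)
    also have "\<dots> = (\<Sum>a<p + q. if a = s then ?T (p + t) s else if a = p + t then ?T s (p + t) else 0)"
      by (rule sum_two_deltas[OF st, symmetric])
    also have "\<dots> = (\<Sum>a<p + q. \<Sum>b<p + q.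
        env_class p q (fa_monom (c * word_mat p (x # w) a b) (unit_word p a b)))"
      by (intro sum.cong refl) (simp add: x zero)
    finally show ?case .
  qed
qed

text \<open>This is the source of injectivity: a class is determined by the matrix entries of any
  representative.\<close>

lemma env_class_expansion:
  fixes x :: "'a::field_char_0 fa"
  assumes pq: "1 < p" "1 < q" and x: "x \<in> free_alg p q"
  shows "env_class p q x =
    (\<Sum>a<p + q. \<Sum>b<p + q. env_class p q (fa_monom (fa_entry p a b x) (unit_word p a b)))"
  using x
proof (induction rule: free_alg_induct)
  case zero
  have "fa_monom (0 :: 'a) v = fa_zero" for v
    by (auto simp: fa_monom_def fa_zero_def)
  then show ?case by simp
next
  case (add_monom x c w)
  have split: "env_class p q (fa_monom (d + e) (unit_word p a b)) =
      env_class p q (fa_monom d (unit_word p a b)) + env_class p q (fa_monom e (unit_word p a b))"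
    if "a < p + q" "b < p + q" for a b and d e :: 'a
  proof -
    have "fa_monom (d + e) v = fa_add (fa_monom d v) (fa_monom e v)" for v
      by (auto simp: fa_monom_def fa_add_def)
    then show ?thesis
      using unit_word_in_words[OF pq that] by (simp add: env_class_add)
  qed
  show ?case
    using add_monom env_class_monom_expansion[OF pq, of w c]
    by (simp add: env_class_add fa_entry_add[of _ p q] split sum.distrib)
qed

section \<open>Surjectivity and kernel of the representation\<close>

lemma fa_rep_surj:
  fixes M :: "'a::field mat"
  assumes pq: "1 < p" "1 < q" and M: "M \<in> carrier_mat (p + q) (p + q)"
  shows "\<exists>x\<in>free_alg p q. fa_rep p q x = M"
proof -
  \<comment> \<open>A preimage is built position by position: S holds the positions already matched,
    and each new one contributes a multiple of its unit word.\<close>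
  have "\<exists>x\<in>free_alg p q. \<forall>c<p + q. \<forall>d<p + q.
      fa_entry p c d x = (if (c, d) \<in> S then M $$ (c, d) else 0)"
    if "finite S" "S \<subseteq> {..<p + q} \<times> {..<p + q}" for S
    using that
  proof (induction S rule: finite_induct)
    case empty
    show ?case by (rule bexI[of _ fa_zero]) simp_all
  next
    case (insert ab S)
    obtain a b where ab: "ab = (a, b)" by (cases ab)
    then have less: "a < p + q" "b < p + q" using insert.prems by auto
    obtain x where x: "x \<in> free_alg p q" and
      entry: "\<And>c d. c < p + q \<Longrightarrow> d < p + q \<Longrightarrow>
        fa_entry p c d x = (if (c, d) \<in> S then M $$ (c, d) else 0)"
      using insert.IH insert.prems by auto
    let ?m = "fa_monom (M $$ (a, b)) (unit_word p a b)"
    have m: "?m \<in> free_alg p q"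
      using unit_word_in_words[OF pq less] by simp
    show ?case
    proof (rule bexI[of _ "fa_add x ?m"])
      show "fa_add x ?m \<in> free_alg p q" using x m by simp
      show "\<forall>c<p + q. \<forall>d<p + q. fa_entry p c d (fa_add x ?m) =
          (if (c, d) \<in> insert ab S then M $$ (c, d) else 0)"
        using insert.hyps(2) x m less pq
        by (auto simp: ab fa_entry_add[of _ p q] entry word_mat_unit_word)
    qed
  qed
  from this[of "{..<p + q} \<times> {..<p + q}"] obtain x where "x \<in> free_alg p q"
    and "\<forall>c<p + q. \<forall>d<p + q. fa_entry p c d x = M $$ (c, d)"
    by auto
  with M show ?thesis
    by (intro bexI[of _ x] eq_matI) (auto simp: fa_rep_def)
qed

text \<open>Equal matrices give equal expansions of the classes, hence a difference in the ideal;
  conversely, all entries vanish on the ideal.\<close>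

lemma fa_rep_eq_iff:
  fixes x y :: "'a::field_char_0 fa"
  assumes pq: "1 < p" "1 < q" and x: "x \<in> free_alg p q" and y: "y \<in> free_alg p q"
  shows "fa_rep p q x = fa_rep p q y \<longleftrightarrow> fa_diff x y \<in> env_ideal p q"
proof
  assume "fa_rep p q x = fa_rep p q y"
  then have "fa_entry p a b x = fa_entry p a b y" if "a < p + q" "b < p + q" for a b
    using that by (metis index_fa_rep)
  then have "env_class p q x = env_class p q y"
    unfolding env_class_expansion[OF pq x] env_class_expansion[OF pq y] by simp
  then show "fa_diff x y \<in> env_ideal p q"
    using x y by (simp add: env_class_eq_iff)
next
  assume "fa_diff x y \<in> env_ideal p q"
  then have "fa_entry p a b (fa_diff x y) = 0" if "a < p + q" "b < p + q" for a b
    using that by (rule fa_entry_env_ideal)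
  then show "fa_rep p q x = fa_rep p q y"
    using x y by (intro eq_matI) (auto simp: fa_rep_def fa_entry_diff[of _ p q])
qed

theorem theorem3p1:
  fixes p q :: nat
  assumes "p > 1" and "q > 1" and "p \<noteq> q"
  shows "\<exists>f :: 'a::field_char_0 fa \<Rightarrow> 'a mat. envelope_iso_to_mat p q (p + q) f"
proof (rule exI[of _ "fa_rep p q"], unfold envelope_iso_to_mat_def, intro conjI ballI allI)
  fix x y :: "'a fa" assume x: "x \<in> free_alg p q" and y: "y \<in> free_alg p q"
  show "fa_rep p q (fa_add x y) = fa_rep p q x + fa_rep p q y"
    using x y by (intro eq_matI) (auto simp: fa_rep_def fa_entry_add)
  show "fa_rep p q (fa_mult x y) = fa_rep p q x * fa_rep p q y"
    using x y
    by (intro eq_matI) (auto simp: fa_rep_def fa_entry_mult scalar_prod_def lessThan_atLeast0)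
  show "fa_rep p q x = fa_rep p q y \<longleftrightarrow> fa_diff x y \<in> env_ideal p q"
    using assms x y by (intro fa_rep_eq_iff) simp_all
next
  fix M :: "'a mat" assume "M \<in> carrier_mat (p + q) (p + q)"
  with assms show "\<exists>x\<in>free_alg p q. fa_rep p q x = M"
    by (intro fa_rep_surj) simp_all
qed (auto simp: fa_rep_def fa_entry_smult intro!: eq_matI)

end
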